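(* Let $n\ge 1$, $d\ge 1$, and let $n$ agents with positions $p_1(k),\dots,p_n(k)\in\mathbb{R}^d$, $k=0,1,2,\dots$, move according to $$p_i(k+1)=p_i(k)-\sigma\sum_{j=1}^{n}\bigl(p_i(k)-p_j(k)\bigr),\qquad i=1,\dots,n .$$ If $0<\sigma<\frac{2}{n}$, then for arbitrary initial positions all agents asymptotically converge to the average location of the initial constellation, i.e. for every $i$, $$\lim_{k\to\infty}p_i(k)=\frac1n\sum_{j=1}^n p_j(0).$$
   Context: This is the discrete-time system $\mathcal{S}_2$ (unlimited visibility, relative position sensing): every agent senses the relative positions of all other agents, and all agents move simultaneously. *)

theory Defs
  imports "HOL-Analysis.Analysis"
begin

end

(* The sum of the positions is invariant, so with c the initial average each step is the
   scalar contraction p i (k+1) - c = (1 - n \<sigma>) (p i k - c), whose ratio has modulus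
   below 1 exactly when 0 < \<sigma> < 2/n. *)
theory Submission
  imports Defs
begin

theorem theorem2:
  fixes n :: nat
    and p :: "nat \<Rightarrow> nat \<Rightarrow> real ^ 'd"
    and \<sigma> :: real
  assumes "n \<ge> 1"
    and "\<And>i k. i \<in> {1..n} \<Longrightarrow>
           p i (Suc k) = p i k - \<sigma> *\<^sub>R (\<Sum>j=1..n. p i k - p j k)"
    and "0 < \<sigma>"
    and "\<sigma> < 2 / real n"
  shows "\<forall>i\<in>{1..n}. (\<lambda>k. p i k) \<longlonglongrightarrow> (1 / real n) *\<^sub>R (\<Sum>j=1..n. p j 0)"
proof
  fix i assume i: "i \<in> {1..n}"
  define S where "S k = (\<Sum>j=1..n. p j k)" for k
  define c where "c = (1 / real n) *\<^sub>R S 0"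
  define r where "r = 1 - real n * \<sigma>"
  \<comment> \<open>Here n \<ge> 1 makes the division in \<open>c\<close> genuine. The update
    contains the sum \<open>S k\<close>, so this form is what lets \<open>c\<close> enter
    it.\<close>
  have nc: "S 0 = real n *\<^sub>R c"
    using assms(1) by (simp add: c_def)
  \<comment> \<open>The other agents enter only through the total \<open>S k\<close>, since the
    constant summand \<open>p j k\<close> contributes n copies of itself.\<close>
  have step: "p j (Suc k) = p j k - \<sigma> *\<^sub>R (real n *\<^sub>R p j k - S k)" if "j \<in> {1..n}" for j k
    using assms(2)[OF that, of k] by (simp add: S_def sum_subtractf sum_constant_scaleR del: sum_constant)
  have "S (Suc k) = S k" for k
  proof -
    have "S (Suc k) = (\<Sum>j=1..n. p j k - \<sigma> *\<^sub>R (real n *\<^sub>R p j k - S k))"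
      unfolding S_def[of "Suc k"] by (rule sum.cong) (simp_all add: step)
    \<comment> \<open>Summed over j, the terms n \<open>p j k\<close> give n \<open>S k\<close>, and
      the n copies of \<open>S k\<close> cancel them.\<close>
    also have "\<dots> = S k - \<sigma> *\<^sub>R (real n *\<^sub>R S k - real n *\<^sub>R S k)"
      by (simp add: S_def sum_subtractf sum_constant_scaleR del: sum_constant flip: scaleR_sum_right)
    finally show ?thesis by simp
  qed
  then have S_const: "S k = S 0" for k
    by (induction k) auto
  have "p i k - c = r ^ k *\<^sub>R (p i 0 - c)" for k
  proof (induction k)
    case (Suc k)
    \<comment> \<open>With \<open>S k\<close> replaced by n \<open>c\<close>, the correction is n
      \<sigma> times the deviation \<open>p i k - c\<close>, which leaves the factor
      \<open>r\<close>.\<close>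
    have "p i (Suc k) - c = r *\<^sub>R (p i k - c)"
      unfolding step[OF i] S_const[of k] nc r_def by (simp add: algebra_simps)
    with Suc show ?case by simp
  qed simp
  then have closed: "p i k = c + r ^ k *\<^sub>R (p i 0 - c)" for k
    by (simp add: algebra_simps)
  \<comment> \<open>The first bound gives \<open>r\<close> < 1, the second -1 < \<open>r\<close>; a
    negative \<open>r\<close> (overshooting \<open>c\<close>) is allowed.\<close>
  have "0 < real n * \<sigma>" "real n * \<sigma> < 2"
    using assms by (simp_all add: field_simps)
  then have "(\<lambda>k. r ^ k) \<longlonglongrightarrow> 0"
    by (intro LIMSEQ_power_zero) (simp add: r_def abs_less_iff)
  then have "(\<lambda>k. c + r ^ k *\<^sub>R (p i 0 - c)) \<longlonglongrightarrow> c + 0 *\<^sub>R (p i 0 - c)"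
    by (intro tendsto_add tendsto_scaleR tendsto_const)
  then show "(\<lambda>k. p i k) \<longlonglongrightarrow> (1 / real n) *\<^sub>R (\<Sum>j=1..n. p j 0)"
    unfolding closed[symmetric] by (simp add: c_def S_def)
qed

end
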